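(* Let $m,n\ge 1$. For vertices $h,h'$ of $\mathrm{OFG}(M_{m,n})$ (given by their normalised height functions), the halved height difference $\phi:=(h'-h)/2$ is an integer $1$-Lipschitz function on $G_{m,n}$, and the graph distance in $\mathrm{OFG}(M_{m,n})$ satisfies $d_{\mathrm{OFG}}(h,h')=\operatorname{disp}(\phi)$. Call an integer $1$-Lipschitz function on $G_{m,n}$ realisable if it equals $(h'-h)/2$ for some such pair $h,h'$. Consequently \begin{align*} \operatorname{diam}\mathrm{OFG}(M_{m,n})&=\max\{\operatorname{disp}(\phi):\phi\text{ realisable}\}\\ &\le\max\{\operatorname{disp}(\phi):\phi\text{ integer $1$-Lipschitz on }G_{m,n}\}. \end{align*}
   Context: $G_{m,n}$ is the grid graph with vertex set $\{(i,j): 1\le i\le m,\ 1\le j\le n\}$, each vertex joined to its horizontal and vertical neighbours. A proper $3$-colouring is a map $c:V(G_{m,n})\to\mathbb{Z}/3\mathbb{Z}$ with $c(u)\ne c(v)$ for every edge $uv$. $\mathrm{OFG}(M_{m,n})$ is the origami flip graph of the $m\times n$ Miura-ori (vertices: flat-foldable mountain--valley assignments; edges: single face flips). Throughout it is identified, by a known bijection, with the following simple graph: its vertices are the orbits of proper $3$-colourings of $G_{m,n}$ under the global colour rotation $c\mapsto c+1$ (action of $\mathbb{Z}/3\mathbb{Z}$), and two distinct orbits are adjacent if and only if they contain representatives that differ at exactly one vertex of $G_{m,n}$. This graph is connected; $d_{\mathrm{OFG}}$ is its graph distance and its diameter is the largest distance between two vertices. A height function is a function $h:V(G_{m,n})\to\mathbb{Z}$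 with $|h(u)-h(v)|=1$ for every edge $uv$. Reduction modulo $3$ gives a bijection between height functions normalised by $h(1,1)=0$ and vertices of $\mathrm{OFG}(M_{m,n})$; each vertex of $\mathrm{OFG}(M_{m,n})$ is identified with its normalised height function. An integer $1$-Lipschitz function on $G_{m,n}$ is a function $\phi:V(G_{m,n})\to\mathbb{Z}$ with $|\phi(u)-\phi(v)|\le 1$ for every edge $uv$. For an integer function $\phi$ on the grid, $\operatorname{disp}(\phi)=\min_{K\in\mathbb{Z}}\sum_{v}|\phi(v)-K|$, the sum running over all vertices $v$ of $G_{m,n}$. Known fact used by the paper (cited from the literature on shortest $3$-recolourings): for vertices of $\mathrm{OFG}(M_{m,n})$ with normalised height functions $h,h'$, $d_{\mathrm{OFG}}(h,h')=\tfrac12\operatorname{disp}(h'-h)$. *)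

theory Defs
  imports
    "Graph_Theory.Graph_Theory"
    "HOL-Library.FuncSet"
    "HOL-Library.Numeral_Type"
begin

text \<open>
  Finite simple graphs are symmetric, loop-free \<open>pair_pre_digraph\<close>s, so every edge is present
  as two opposite arcs. Functions on the vertices of the grid are extensional, so that equality of
  functions is equality on the grid. The numeral type \<open>3\<close> is the ring of integers modulo 3.
\<close>

type_synonym cell = "nat \<times> nat"

definition grid :: "nat \<Rightarrow> nat \<Rightarrow> cell pair_pre_digraph" where
  "grid m n = \<lparr>
     pverts = {1..m} \<times> {1..n},
     parcs = {((i, j), (k, l)) | i j k l.
        (i, j) \<in> {1..m} \<times> {1..n} \<and> (k, l) \<in> {1..m} \<times> {1..n} \<and>
        (i = k \<and> (l = Suc j \<or> j = Suc l) \<or> j = l \<and> (k = Suc i \<or> i = Suc k))} \<rparr>"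

definition proper_colourings :: "nat \<Rightarrow> nat \<Rightarrow> (cell \<Rightarrow> 3) set" where
  "proper_colourings m n =
     {c \<in> pverts (grid m n) \<rightarrow>\<^sub>E UNIV. \<forall>(u, v) \<in> parcs (grid m n). c u \<noteq> c v}"

definition rotate_colours :: "nat \<Rightarrow> nat \<Rightarrow> 3 \<Rightarrow> (cell \<Rightarrow> 3) \<Rightarrow> (cell \<Rightarrow> 3)" where
  "rotate_colours m n k c = (\<lambda>v \<in> pverts (grid m n). c v + k)"

definition colour_orbit :: "nat \<Rightarrow> nat \<Rightarrow> (cell \<Rightarrow> 3) \<Rightarrow> (cell \<Rightarrow> 3) set" where
  "colour_orbit m n c = range (\<lambda>k. rotate_colours m n k c)"

definition ofg :: "nat \<Rightarrow> nat \<Rightarrow> (cell \<Rightarrow> 3) set pair_pre_digraph" where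
  "ofg m n = \<lparr>
     pverts = colour_orbit m n ` proper_colourings m n,
     parcs = {(X, Y).
        X \<in> colour_orbit m n ` proper_colourings m n \<and>
        Y \<in> colour_orbit m n ` proper_colourings m n \<and> X \<noteq> Y \<and>
        (\<exists>c \<in> X. \<exists>d \<in> Y. \<exists>!v. v \<in> pverts (grid m n) \<and> c v \<noteq> d v)} \<rparr>"

text \<open>
  Graph distance is the shortest-path distance for unit arc weights; it is infinite between
  vertices in different components.
\<close>

definition graph_dist :: "'a pair_pre_digraph \<Rightarrow> 'a \<Rightarrow> 'a \<Rightarrow> ereal" where
  "graph_dist G u v = wf_digraph.\<mu> (with_proj G) (\<lambda>_. 1) u v"

definition graph_diam :: "'a pair_pre_digraph \<Rightarrow> ereal" where
  "graph_diam G = Max {graph_dist G u v | u v. u \<in> pverts G \<and> v \<in> pverts G}"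

definition normalised_heights :: "nat \<Rightarrow> nat \<Rightarrow> (cell \<Rightarrow> int) set" where
  "normalised_heights m n =
     {h \<in> pverts (grid m n) \<rightarrow>\<^sub>E UNIV.
        (\<forall>(u, v) \<in> parcs (grid m n). \<bar>h u - h v\<bar> = 1) \<and> h (1, 1) = 0}"

definition ofg_vertex :: "nat \<Rightarrow> nat \<Rightarrow> (cell \<Rightarrow> int) \<Rightarrow> (cell \<Rightarrow> 3) set" where
  "ofg_vertex m n h = colour_orbit m n (\<lambda>v \<in> pverts (grid m n). of_int (h v))"

definition lipschitz_functions :: "nat \<Rightarrow> nat \<Rightarrow> (cell \<Rightarrow> int) set" where
  "lipschitz_functions m n =
     {\<phi> \<in> pverts (grid m n) \<rightarrow>\<^sub>E UNIV. \<forall>(u, v) \<in> parcs (grid m n). \<bar>\<phi> u - \<phi> v\<bar> \<le> 1}"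

text \<open>The division is the one on the reals, so that integrality of the values is part of the claim.\<close>

definition halved_difference ::
  "nat \<Rightarrow> nat \<Rightarrow> (cell \<Rightarrow> int) \<Rightarrow> (cell \<Rightarrow> int) \<Rightarrow> (cell \<Rightarrow> int) \<Rightarrow> bool" where
  "halved_difference m n h h' \<phi> \<longleftrightarrow>
     (\<forall>v \<in> pverts (grid m n). real_of_int (\<phi> v) = (real_of_int (h' v) - real_of_int (h v)) / 2)"

definition realisable_functions :: "nat \<Rightarrow> nat \<Rightarrow> (cell \<Rightarrow> int) set" where
  "realisable_functions m n =
     {\<phi> \<in> lipschitz_functions m n.
        \<exists>h \<in> normalised_heights m n. \<exists>h' \<in> normalised_heights m n. halved_difference m n h h' \<phi>}"

text \<open>The minimum over \<open>K\<close> is that of a nonempty set of natural numbers.\<close>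

definition disp :: "nat \<Rightarrow> nat \<Rightarrow> (cell \<Rightarrow> int) \<Rightarrow> nat" where
  "disp m n \<phi> = (LEAST s. \<exists>K :: int. s = (\<Sum>v \<in> pverts (grid m n). nat \<bar>\<phi> v - K\<bar>))"

lemma grid_pverts [simp]: "pverts (grid m n) = {1..m} \<times> {1..n}"
  by (simp add: grid_def)

lemma pair_graph_grid: "pair_graph (grid m n)"
proof
  show "finite (pverts (grid m n))" by simp
  show "finite (parcs (grid m n))"
    by (rule finite_subset[of _ "pverts (grid m n) \<times> pverts (grid m n)"]) (auto simp: grid_def)
  show "symmetric (grid m n)"
    unfolding symmetric_def sym_def by (auto simp: grid_def)
qed (auto simp: grid_def)

lemma finite_proper_colourings: "finite (proper_colourings m n)"
proof (rule finite_subset)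
  show "finite (pverts (grid m n) \<rightarrow>\<^sub>E (UNIV :: 3 set))"
    by (intro finite_PiE) auto
qed (auto simp: proper_colourings_def)

lemma pair_graph_ofg: "pair_graph (ofg m n)"
proof
  show fin: "finite (pverts (ofg m n))"
    using finite_proper_colourings by (simp add: ofg_def)
  show "finite (parcs (ofg m n))"
    by (rule finite_subset[OF _ finite_cartesian_product[OF fin fin]]) (auto simp: ofg_def)
  show "symmetric (ofg m n)"
    unfolding symmetric_def sym_def
  proof (intro allI impI)
    fix X Y assume "(X, Y) \<in> arcs_ends (with_proj (ofg m n))"
    then have *: "(X, Y) \<in> parcs (ofg m n)" by simp
    then have "\<exists>c \<in> X. \<exists>d \<in> Y. \<exists>!v. v \<in> pverts (grid m n) \<and> c v \<noteq> d v"
      by (simp add: ofg_def del: grid_pverts)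
    then have "\<exists>d \<in> Y. \<exists>c \<in> X. \<exists>!v. v \<in> pverts (grid m n) \<and> d v \<noteq> c v"
    proof (elim bexE)
      fix c d assume cd: "c \<in> X" "d \<in> Y" "\<exists>!v. v \<in> pverts (grid m n) \<and> c v \<noteq> d v"
      have "(\<lambda>v. c v \<noteq> d v) = (\<lambda>v. d v \<noteq> c v)" by auto
      with cd(3) have "\<exists>!v. v \<in> pverts (grid m n) \<and> d v \<noteq> c v" by metis
      with cd(1,2) show ?thesis by blast
    qed
    with * have "(Y, X) \<in> parcs (ofg m n)" 
      by (simp add: ofg_def del: grid_pverts) blast
    then show "(Y, X) \<in> arcs_ends (with_proj (ofg m n))" by simp
  qed
qed (auto simp: ofg_def)

lemma of_int_3_eq_iff: "(of_int x :: 3) = of_int y \<longleftrightarrow> 3 dvd (x - y)"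
  using of_int_eq_0_iff_char_dvd[where 'a = 3, of "x - y"] by simp

lemma parcs_grid_iff:
  "((i, j), (k, l)) \<in> parcs (grid m n) \<longleftrightarrow>
     1 \<le> i \<and> i \<le> m \<and> 1 \<le> j \<and> j \<le> n \<and> 1 \<le> k \<and> k \<le> m \<and> 1 \<le> l \<and> l \<le> n \<and>
     (i = k \<and> (l = Suc j \<or> j = Suc l) \<or> j = l \<and> (k = Suc i \<or> i = Suc k))"
  by (auto simp: grid_def)

lemma ofg_vertex_inj: "inj_on (ofg_vertex m n) (normalised_heights m n)"
proof (rule inj_onI)
  fix h g
  assume h: "h \<in> normalised_heights m n" and g: "g \<in> normalised_heights m n"
    and eq: "ofg_vertex m n h = ofg_vertex m n g"
  define V where "V = pverts (grid m n)"
  have "rotate_colours m n 0 (\<lambda>v \<in> V. of_int (h v)) \<in> ofg_vertex m n h"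
    unfolding ofg_vertex_def colour_orbit_def V_def by (rule rangeI)
  then have "rotate_colours m n 0 (\<lambda>v \<in> V. of_int (h v)) \<in> ofg_vertex m n g"
    by (simp only: eq)
  then obtain k where k: "rotate_colours m n 0 (\<lambda>v \<in> V. of_int (h v)) =
      rotate_colours m n k (\<lambda>v \<in> V. of_int (g v))"
    unfolding ofg_vertex_def colour_orbit_def V_def by blast
  have k': "(of_int (h v) :: 3) = of_int (g v) + k" if "v \<in> V" for v
    using fun_cong[OF k, of v] that by (simp add: rotate_colours_def V_def)
  have dvd: "3 dvd (h v - g v)" if v: "v \<in> V" for v
  proof -
    have "(1, 1) \<in> V" using v by (auto simp: V_def)
    from k'[OF this] have "k = 0"
      using h g by (simp add: normalised_heights_def)
    with k'[OF v] show ?thesis by (simp add: of_int_3_eq_iff)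
  qed
  have step: "h v = g v" if uv: "(u, v) \<in> parcs (grid m n)" and "h u = g u" for u v
  proof -
    have "v \<in> V" using uv by (cases u; cases v) (auto simp: V_def parcs_grid_iff)
    moreover have "\<bar>h u - h v\<bar> = 1" "\<bar>g u - g v\<bar> = 1"
      using h g uv by (auto simp: normalised_heights_def)
    ultimately show ?thesis using dvd[of v] \<open>h u = g u\<close> by presburger
  qed
  have col: "1 \<le> i \<Longrightarrow> i \<le> m \<Longrightarrow> 1 \<le> n \<Longrightarrow> h (i, 1) = g (i, 1)" for i
  proof (induction i)
    case (Suc i)
    show ?case
    proof (cases "i = 0")
      case True
      then show ?thesis using h g by (simp add: normalised_heights_def)
    next
      case False
      show ?thesis
        by (rule step[of "(i, 1)"]) (use Suc False in \<open>auto simp: parcs_grid_iff\<close>)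
    qed
  qed simp
  have all: "1 \<le> i \<Longrightarrow> i \<le> m \<Longrightarrow> 1 \<le> j \<Longrightarrow> j \<le> n \<Longrightarrow> h (i, j) = g (i, j)" for i j
  proof (induction j)
    case (Suc j)
    show ?case
    proof (cases "j = 0")
      case True
      then show ?thesis using col[of i] Suc by simp
    next
      case False
      show ?thesis
        by (rule step[of "(i, j)"]) (use Suc False in \<open>auto simp: parcs_grid_iff\<close>)
    qed
  qed simp
  show "h = g"
  proof (rule PiE_ext)
    show "h \<in> pverts (grid m n) \<rightarrow>\<^sub>E UNIV" "g \<in> pverts (grid m n) \<rightarrow>\<^sub>E UNIV"
      using h g by (auto simp only: normalised_heights_def)
  qed (auto intro: all)
qed

definition colour_step :: "3 \<Rightarrow> 3 \<Rightarrow> int" where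
  "colour_step a b = (if b = a + 1 then 1 else - 1)"

lemma Z3_cases: obtains "(a :: 3) = 0" | "a = 1" | "a = 2"
proof (cases a)
  case (of_int z)
  then have "z = 0 \<or> z = 1 \<or> z = 2" by auto
  with of_int that show ?thesis by auto
qed

lemma colour_step_of_int: "a \<noteq> b \<Longrightarrow> of_int (colour_step a b) = b - a"
  by (cases a rule: Z3_cases; cases b rule: Z3_cases) (auto simp: colour_step_def)

lemma colour_step_square:
  assumes "a \<noteq> b" "b \<noteq> d" "a \<noteq> e" "e \<noteq> d"
  shows "colour_step a b + colour_step b d = colour_step a e + colour_step e d"
proof -
  have "(of_int (colour_step a b + colour_step b d) :: 3) =
      of_int (colour_step a e + colour_step e d)"
    using assms by (simp add: colour_step_of_int)
  then have "3 dvd (colour_step a b + colour_step b d - (colour_step a e + colour_step e d))"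
    by (simp only: of_int_3_eq_iff)
  then show ?thesis by (auto simp: colour_step_def split: if_splits)
qed

lemma ofg_vertex_surj:
  assumes mn: "1 \<le> m" "1 \<le> n" and c: "c \<in> proper_colourings m n"
  shows "\<exists>h \<in> normalised_heights m n. ofg_vertex m n h = colour_orbit m n c"
proof -
  define H where "H i j = (\<Sum>k = 1..<i. colour_step (c (k, 1)) (c (Suc k, 1))) +
      (\<Sum>l = 1..<j. colour_step (c (i, l)) (c (i, Suc l)))" for i j
  define h where "h = (\<lambda>(i, j) \<in> pverts (grid m n). H i j)"
  have ne: "c u \<noteq> c v" if "(u, v) \<in> parcs (grid m n)" for u v
    using c that by (auto simp: proper_colourings_def)
  have hor: "H i (Suc j) - H i j = colour_step (c (i, j)) (c (i, Suc j))" if "1 \<le> j" for i j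
    using that by (simp add: H_def)
  have ver: "H (Suc i) j - H i j = colour_step (c (i, j)) (c (Suc i, j))"
    if "1 \<le> i" "Suc i \<le> m" "1 \<le> j" "j \<le> n" for i j
    using that(3,4)
  proof (induction j)
    case (Suc j)
    show ?case
    proof (cases "j = 0")
      case True
      then show ?thesis using that by (simp add: H_def)
    next
      case False
      have "colour_step (c (i, j)) (c (Suc i, j)) + colour_step (c (Suc i, j)) (c (Suc i, Suc j)) =
          colour_step (c (i, j)) (c (i, Suc j)) + colour_step (c (i, Suc j)) (c (Suc i, Suc j))"
        by (rule colour_step_square; rule ne) (use that False Suc in \<open>auto simp: parcs_grid_iff\<close>)
      with Suc False hor[of j i] hor[of j "Suc i"] show ?thesis by simp
    qed
  qed simp
  have step: "H k l - H i j = colour_step (c (i, j)) (c (k, l))"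
    if "((i, j), (k, l)) \<in> parcs (grid m n)" "k = Suc i \<or> l = Suc j" for i j k l
    using that hor[of j i] ver[of i j] by (auto simp: parcs_grid_iff)
  have abs_step: "\<bar>H i j - H k l\<bar> = 1" if "((i, j), (k, l)) \<in> parcs (grid m n)" for i j k l
  proof (cases "k = Suc i \<or> l = Suc j")
    case True
    from step[OF that True] show ?thesis by (auto simp: colour_step_def split: if_splits)
  next
    case False
    with that have "((k, l), (i, j)) \<in> parcs (grid m n)" "i = Suc k \<or> j = Suc l"
      by (auto simp: parcs_grid_iff)
    from step[OF this] show ?thesis by (auto simp: colour_step_def split: if_splits)
  qed
  have col: "1 \<le> i \<Longrightarrow> i \<le> m \<Longrightarrow> 1 \<le> n \<Longrightarrow> of_int (H i 1) = c (i, 1) - c (1, 1)" for i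
  proof (induction i)
    case (Suc i)
    show ?case
    proof (cases "i = 0")
      case False
      have "of_int (H (Suc i) 1) =
          (of_int (H i 1) + of_int (colour_step (c (i, 1)) (c (Suc i, 1))) :: 3)"
        using ver[of i 1] Suc.prems False by (simp only: of_int_add[symmetric]) (simp add: algebra_simps del: of_int_add)
      moreover have "c (i, 1) \<noteq> c (Suc i, 1)"
        using Suc.prems False by (intro ne) (auto simp: parcs_grid_iff)
      ultimately show ?thesis using Suc False by (simp add: colour_step_of_int)
    qed (simp add: H_def)
  qed simp
  have all: "1 \<le> i \<Longrightarrow> i \<le> m \<Longrightarrow> 1 \<le> j \<Longrightarrow> j \<le> n \<Longrightarrow> of_int (H i j) = c (i, j) - c (1, 1)" for i j
  proof (induction j)
    case (Suc j)
    show ?case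
    proof (cases "j = 0")
      case True
      then show ?thesis using col[of i] Suc by simp
    next
      case False
      have "of_int (H i (Suc j)) =
          (of_int (H i j) + of_int (colour_step (c (i, j)) (c (i, Suc j))) :: 3)"
        using hor[of j i] False by (simp only: of_int_add[symmetric]) (simp add: algebra_simps del: of_int_add)
      moreover have "c (i, j) \<noteq> c (i, Suc j)"
        using Suc.prems False by (intro ne) (auto simp: parcs_grid_iff)
      ultimately show ?thesis using Suc False by (simp add: colour_step_of_int)
    qed
  qed simp
  have h_eq: "of_int (h v) = c v - c (1, 1)" if "v \<in> pverts (grid m n)" for v
    using that all by (cases v) (simp add: h_def)
  have orbit: "colour_orbit m n (\<lambda>v \<in> pverts (grid m n). of_int (h v)) = colour_orbit m n c"
  proof -
    have rot: "rotate_colours m n k (\<lambda>v \<in> pverts (grid m n). of_int (h v)) =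
        rotate_colours m n (k - c (1, 1)) c" for k
      unfolding rotate_colours_def by (rule restrict_ext) (simp add: h_eq del: grid_pverts)
    have "range (\<lambda>k. rotate_colours m n (k - c (1, 1)) c) =
        (\<lambda>k. rotate_colours m n k c) ` range (\<lambda>k. k - c (1, 1))"
      by (simp only: image_image)
    also have "range (\<lambda>k. k - c (1, 1)) = UNIV"
      by (rule surjI[of _ "\<lambda>k. k + c (1, 1)"]) simp
    finally show ?thesis unfolding colour_orbit_def rot .
  qed
  have "\<bar>h u - h v\<bar> = 1" if "(u, v) \<in> parcs (grid m n)" for u v
    using that abs_step
    by (cases u; cases v) (auto simp: h_def parcs_grid_iff)
  moreover have "h (1, 1) = 0"
    using mn by (simp add: h_def H_def)
  moreover have "h \<in> pverts (grid m n) \<rightarrow>\<^sub>E UNIV"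
    unfolding h_def by auto
  ultimately have "h \<in> normalised_heights m n"
    using mn by (auto simp: normalised_heights_def)
  with orbit show ?thesis unfolding ofg_vertex_def by blast
qed

lemma ofg_vertex_in:
  assumes h: "h \<in> normalised_heights m n"
  shows "ofg_vertex m n h \<in> pverts (ofg m n)"
proof -
  have "(of_int (h u) :: 3) \<noteq> of_int (h v)" if "(u, v) \<in> parcs (grid m n)" for u v
  proof
    assume "(of_int (h u) :: 3) = of_int (h v)"
    then have "3 dvd (h u - h v)" by (simp only: of_int_3_eq_iff)
    moreover have "\<bar>h u - h v\<bar> = 1" using h that by (auto simp: normalised_heights_def)
    ultimately show False by presburger
  qed
  then have "(\<lambda>v \<in> pverts (grid m n). of_int (h v)) \<in> proper_colourings m n"
    by (auto simp: proper_colourings_def parcs_grid_iff)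
  then show ?thesis unfolding ofg_vertex_def ofg_def by simp
qed

text \<open>
  Reduction modulo 3 identifies normalised height functions with the vertices of the graph, so
  quantifying over \<open>normalised_heights\<close> is quantifying over vertices.
\<close>

lemma bij_betw_ofg_vertex:
  assumes "1 \<le> m" "1 \<le> n"
  shows "bij_betw (ofg_vertex m n) (normalised_heights m n) (pverts (ofg m n))"
proof (rule bij_betw_imageI)
  show "ofg_vertex m n ` normalised_heights m n = pverts (ofg m n)"
  proof
    show "pverts (ofg m n) \<subseteq> ofg_vertex m n ` normalised_heights m n"
    proof
      fix X assume "X \<in> pverts (ofg m n)"
      then obtain c where "c \<in> proper_colourings m n" "X = colour_orbit m n c"
        by (auto simp: ofg_def)
      with ofg_vertex_surj[OF assms] show "X \<in> ofg_vertex m n ` normalised_heights m n" by blast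
    qed
  qed (auto intro: ofg_vertex_in)
qed (rule ofg_vertex_inj)

end

theory Submission
  imports Defs
begin

text \<open>
  Dropping the normalisation, an edge of the flip graph is a change of a height function by
  \<open>\<plusminus> 2\<close> at a single cell, so a walk of length \<open>k\<close> moves a height function by at most \<open>2 * k\<close>
  in the \<open>l\<^sup>1\<close> norm; renormalising at the end contributes the constant \<open>K\<close> of \<open>disp\<close>.
  Conversely, if \<open>g\<close> lies below \<open>g'\<close> somewhere, then a cell of smallest height \<open>g\<close> among
  those with \<open>g < g'\<close> is a local minimum of \<open>g\<close>, and raising \<open>g\<close> there brings it closer
  to \<open>g'\<close>. Hence the \<open>l\<^sup>1\<close> distance can be exhausted by flips.
\<close>

section \<open>Graph distance and relation powers\<close>

text \<open>Walk lengths become exponents of the arc relation, so the later inductions need no arc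
  lists. Walks are built at the head whereas \<open>relpow\<close> unfolds at the tail, hence
  \<open>relpow_Suc_I2\<close>.\<close>

lemma awalk_imp_relpow:
  assumes "pair_wf_digraph G" "pre_digraph.awalk (with_proj G) u p v"
  shows "(u, v) \<in> parcs G ^^ length p"
proof -
  interpret pair_wf_digraph G by fact
  from assms(2) show ?thesis
    by (induction p arbitrary: u) (auto simp: awalk_simps simp del: relpow.simps(2) intro: relpow_Suc_I2)
qed

text \<open>The hypothesis on \<open>u\<close> serves the case \<open>k = 0\<close>: the zeroth
  power relates every element to itself, but the empty walk must sit at a vertex.\<close>

lemma relpow_imp_awalk:
  assumes "pair_wf_digraph G" "u \<in> pverts G" "(u, v) \<in> parcs G ^^ k"
  shows "\<exists>p. pre_digraph.awalk (with_proj G) u p v \<and> length p = k"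
proof -
  interpret pair_wf_digraph G by fact
  from assms(2,3) show ?thesis
  proof (induction k arbitrary: u)
    case 0
    then show ?case by (simp add: awalk_Nil_iff)
  next
    case (Suc k)
    from Suc.prems(2) obtain w where w: "(u, w) \<in> parcs G" "(w, v) \<in> parcs G ^^ k"
      by (rule relpow_Suc_E2)
    then have "w \<in> pverts G" using in_arcsD2 by blast
    from Suc.IH[OF this w(2)] obtain p where "awalk w p v" "length p = k" by blast
    with w(1) have "awalk u ((u, w) # p) v" "length ((u, w) # p) = Suc k"
      by (auto simp: awalk_Cons_iff)
    then show ?case by blast
  qed
qed

lemma (in wf_digraph) awalk_cost_one: "awalk_cost (\<lambda>_. 1) p = real (length p)"
  by (induction p) simp_all

lemma graph_dist_le:
  assumes "pair_wf_digraph G" "u \<in> pverts G" "(u, v) \<in> parcs G ^^ k"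
  shows "graph_dist G u v \<le> ereal k"
proof -
  interpret pair_wf_digraph G by fact
  obtain p where "awalk u p v" "length p = k"
    using relpow_imp_awalk[OF assms] by blast
  with min_cost_le_walk_cost[of u p v "\<lambda>_. 1"] show ?thesis
    by (simp add: graph_dist_def awalk_cost_one)
qed

text \<open>The distance is an infimum of walk costs, so a lower bound on all walk lengths passes to
  it; if there is no walk, the infimum is infinite.\<close>

lemma graph_dist_ge:
  assumes "pair_wf_digraph G" "\<And>k. (u, v) \<in> parcs G ^^ k \<Longrightarrow> d \<le> k"
  shows "ereal (real d) \<le> graph_dist G u v"
proof -
  interpret pair_wf_digraph G by fact
  show ?thesis
    unfolding graph_dist_def \<mu>_def
    using assms(2) awalk_imp_relpow[OF assms(1)]
    by (auto intro!: INF_greatest simp: awalk_cost_one)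
qed

section \<open>Height functions without normalisation\<close>

text \<open>A flip at \<open>(1, 1)\<close> destroys the condition \<open>h (1, 1) = 0\<close>, so
  walks are followed among height functions that are free at this cell.\<close>

definition heights :: "nat \<Rightarrow> nat \<Rightarrow> (cell \<Rightarrow> int) set" where
  "heights m n = {h \<in> pverts (grid m n) \<rightarrow>\<^sub>E UNIV. \<forall>(u, v) \<in> parcs (grid m n). \<bar>h u - h v\<bar> = 1}"

lemma heightsI:
  assumes "h \<in> pverts (grid m n) \<rightarrow>\<^sub>E UNIV"
    and "\<And>u v. (u, v) \<in> parcs (grid m n) \<Longrightarrow> \<bar>h u - h v\<bar> = 1"
  shows "h \<in> heights m n"
  using assms unfolding heights_def by blast

lemma heights_arc: "h \<in> heights m n \<Longrightarrow> (u, v) \<in> parcs (grid m n) \<Longrightarrow> \<bar>h u - h v\<bar> = 1"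
  by (auto simp: heights_def)

lemma normalised_heights_iff: "h \<in> normalised_heights m n \<longleftrightarrow> h \<in> heights m n \<and> h (1, 1) = 0"
  by (auto simp: heights_def normalised_heights_def)

lemma heights_ext:
  assumes "g \<in> heights m n" "h \<in> heights m n" "\<And>v. v \<in> pverts (grid m n) \<Longrightarrow> g v = h v"
  shows "g = h"
  by (rule PiE_ext[of _ "pverts (grid m n)" "\<lambda>_. UNIV"]) (use assms in \<open>auto simp only: heights_def\<close>)

lemma grid_arc_in_verts:
  assumes "(u, v) \<in> parcs (grid m n)"
  shows "u \<in> pverts (grid m n)" "v \<in> pverts (grid m n)"
  using assms by (cases u; cases v; auto simp: parcs_grid_iff)+

lemma grid_arc_sym: "(u, v) \<in> parcs (grid m n) \<Longrightarrow> (v, u) \<in> parcs (grid m n)"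
  by (cases u; cases v) (auto simp: parcs_grid_iff)

text \<open>This is connectedness of the grid: \<open>(i, 1)\<close> is reached by increasing the
  first coordinate, then \<open>(i, j)\<close> by increasing the second.\<close>

lemma grid_induct:
  assumes base: "P (1, 1)"
    and step: "\<And>u v. (u, v) \<in> parcs (grid m n) \<Longrightarrow> P u \<Longrightarrow> P v"
    and v: "v \<in> pverts (grid m n)"
  shows "P v"
proof -
  have col: "1 \<le> i \<Longrightarrow> i \<le> m \<Longrightarrow> 1 \<le> n \<Longrightarrow> P (i, 1)" for i
  proof (induction i rule: nat_induct_at_least)
    case (Suc i)
    then show ?case by (intro step[of "(i, 1)" "(Suc i, 1)"]) (auto simp: parcs_grid_iff)
  qed (use base in simp)
  have "1 \<le> j \<Longrightarrow> j \<le> n \<Longrightarrow> 1 \<le> i \<Longrightarrow> i \<le> m \<Longrightarrow> P (i, j)" for i j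
  proof (induction j rule: nat_induct_at_least)
    case base
    then show ?case by (intro col) auto
  next
    case (Suc j)
    then show ?case by (intro step[of "(i, j)" "(i, Suc j)"]) (auto simp: parcs_grid_iff)
  qed
  with v show ?thesis by auto
qed

text \<open>Along an edge both heights change by an odd amount, so the parity of their difference is
  the same at all cells.\<close>

lemma even_height_diff:
  assumes "g \<in> heights m n" "h \<in> heights m n" "even (g (1, 1) - h (1, 1))" "v \<in> pverts (grid m n)"
  shows "even (g v - h v)"
  using assms(3) _ assms(4)
proof (rule grid_induct)
  fix u w assume uw: "(u, w) \<in> parcs (grid m n)" "even (g u - h u)"
  from heights_arc[OF assms(1) uw(1)] heights_arc[OF assms(2) uw(1)] uw(2)
  show "even (g w - h w)" by presburger
qed

lemma mem_ofg_vertex: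
  "c \<in> ofg_vertex m n h \<longleftrightarrow> (\<exists>k. c = (\<lambda>v \<in> pverts (grid m n). of_int (h v) + k))"
proof -
  have "rotate_colours m n k (\<lambda>v \<in> pverts (grid m n). of_int (h v)) =
      (\<lambda>v \<in> pverts (grid m n). of_int (h v) + k)" for k
    by (auto simp: rotate_colours_def)
  then show ?thesis by (auto simp: ofg_vertex_def colour_orbit_def)
qed

text \<open>Congruence modulo 3 up to one common rotation is enough; the two functions need not be
  known to be height functions.\<close>

lemma ofg_vertex_eqI:
  assumes "\<And>v. v \<in> pverts (grid m n) \<Longrightarrow> (of_int (g v) :: 3) = of_int (h v) + k"
  shows "ofg_vertex m n g = ofg_vertex m n h"
proof (intro set_eqI iffI)
  fix c assume "c \<in> ofg_vertex m n g"
  then obtain l where "c = (\<lambda>v \<in> pverts (grid m n). of_int (g v) + l)"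
    by (auto simp only: mem_ofg_vertex)
  also have "\<dots> = (\<lambda>v \<in> pverts (grid m n). of_int (h v) + (k + l))"
    using assms by (intro restrict_ext) (simp add: algebra_simps del: grid_pverts)
  finally show "c \<in> ofg_vertex m n h" by (auto simp only: mem_ofg_vertex)
next
  fix c assume "c \<in> ofg_vertex m n h"
  then obtain l where "c = (\<lambda>v \<in> pverts (grid m n). of_int (h v) + l)"
    by (auto simp only: mem_ofg_vertex)
  also have "\<dots> = (\<lambda>v \<in> pverts (grid m n). of_int (g v) + (l - k))"
    using assms by (intro restrict_ext) (simp add: algebra_simps del: grid_pverts)
  finally show "c \<in> ofg_vertex m n g" by (auto simp only: mem_ofg_vertex)
qed

lemma heights_shift: "h \<in> heights m n \<Longrightarrow> (\<lambda>v \<in> pverts (grid m n). h v + k) \<in> heights m n"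
  by (auto simp: heights_def parcs_grid_iff)

lemma ofg_vertex_shift:
  "ofg_vertex m n (\<lambda>v \<in> pverts (grid m n). h v + k) = ofg_vertex m n h"
  by (rule ofg_vertex_eqI[of _ _ _ _ "of_int k"]) (simp del: grid_pverts)

lemma ofg_vertex_heights_in:
  assumes "1 \<le> m" "1 \<le> n" "h \<in> heights m n"
  shows "ofg_vertex m n h \<in> pverts (ofg m n)"
proof -
  have "(\<lambda>v \<in> pverts (grid m n). h v + - h (1, 1)) \<in> normalised_heights m n"
    using assms heights_shift[OF assms(3), of "- h (1, 1)"] by (simp add: normalised_heights_iff)
  from ofg_vertex_in[OF this] show ?thesis by (simp only: ofg_vertex_shift)
qed

text \<open>Subtracting \<open>g (1, 1)\<close> normalises \<open>g\<close> without changing its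
  orbit, and reduction modulo 3 is injective on normalised heights.\<close>

lemma ofg_vertex_eqD:
  assumes mn: "1 \<le> m" "1 \<le> n" and g: "g \<in> heights m n" and h: "h \<in> normalised_heights m n"
    and eq: "ofg_vertex m n g = ofg_vertex m n h" and v: "v \<in> pverts (grid m n)"
  shows "h v = g v - g (1, 1)"
proof -
  let ?g = "\<lambda>v \<in> pverts (grid m n). g v + - g (1, 1)"
  have "?g \<in> normalised_heights m n"
    using mn heights_shift[OF g, of "- g (1, 1)"] by (simp add: normalised_heights_iff)
  moreover have "ofg_vertex m n ?g = ofg_vertex m n h"
    by (simp only: ofg_vertex_shift eq)
  ultimately have "?g = h" using h inj_onD[OF ofg_vertex_inj] by blast
  with v show ?thesis by (auto simp del: grid_pverts)
qed

section \<open>Arcs of the flip graph\<close>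

lemma flip_heights:
  assumes h: "h \<in> heights m n" and v: "v \<in> pverts (grid m n)"
    and nb: "\<And>w. (v, w) \<in> parcs (grid m n) \<Longrightarrow> \<bar>h v + e - h w\<bar> = 1"
  shows "h(v := h v + e) \<in> heights m n"
proof -
  have "\<bar>(h(v := h v + e)) u - (h(v := h v + e)) w\<bar> = 1" if uw: "(u, w) \<in> parcs (grid m n)" for u w
  proof -
    have "u \<noteq> w" using uw by (cases u) (auto simp: parcs_grid_iff)
    then show ?thesis
      using nb[of w] nb[of u] uw grid_arc_sym[OF uw] heights_arc[OF h uw] by (auto simp: abs_minus_commute)
  qed
  moreover have "h(v := h v + e) \<in> pverts (grid m n) \<rightarrow>\<^sub>E UNIV"
    using h v by (auto simp: heights_def PiE_def extensional_def)
  ultimately show ?thesis by (rule heightsI[rotated])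
qed

lemma ofg_arc_iff:
  "(X, Y) \<in> parcs (ofg m n) \<longleftrightarrow> X \<in> pverts (ofg m n) \<and> Y \<in> pverts (ofg m n) \<and> X \<noteq> Y \<and>
     (\<exists>c \<in> X. \<exists>d \<in> Y. \<exists>!v. v \<in> pverts (grid m n) \<and> c v \<noteq> d v)"
  by (simp only: ofg_def pair_pre_digraph.simps mem_Collect_eq case_prod_conv)

text \<open>Since 2 is nonzero modulo 3, the flip changes the colour of \<open>v\<close> and of no
  other cell. The hypothesis \<open>ne\<close> excludes the one-cell grid, where a flip is a global
  rotation and the two orbits coincide.\<close>

lemma flip_imp_arc:
  assumes mn: "1 \<le> m" "1 \<le> n" and h: "h \<in> heights m n" and v: "v \<in> pverts (grid m n)"
    and g: "h(v := h v + 2) \<in> heights m n"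
    and ne: "ofg_vertex m n h \<noteq> ofg_vertex m n (h(v := h v + 2))"
  shows "(ofg_vertex m n h, ofg_vertex m n (h(v := h v + 2))) \<in> parcs (ofg m n)"
proof -
  \<comment> \<open>The summand 0 is the rotation \<open>k\<close> in
    \<open>mem_ofg_vertex\<close>.\<close>
  let ?c = "\<lambda>u \<in> pverts (grid m n). (of_int (h u) :: 3) + 0"
  let ?d = "\<lambda>u \<in> pverts (grid m n). (of_int ((h(v := h v + 2)) u) :: 3) + 0"
  have "?c \<in> ofg_vertex m n h" "?d \<in> ofg_vertex m n (h(v := h v + 2))"
    by (auto simp only: mem_ofg_vertex)
  moreover have "\<exists>!u. u \<in> pverts (grid m n) \<and> ?c u \<noteq> ?d u"
    by (rule ex1I[of _ v]) (use v in \<open>auto split: if_splits\<close>)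
  ultimately show ?thesis
    unfolding ofg_arc_iff
    by (intro conjI ofg_vertex_heights_in[OF mn h] ofg_vertex_heights_in[OF mn g] ne bexI)
qed

lemma ofg_arc_sym: "(X, Y) \<in> parcs (ofg m n) \<Longrightarrow> (Y, X) \<in> parcs (ofg m n)"
proof -
  interpret pair_graph "ofg m n" by (rule pair_graph_ofg)
  show "(X, Y) \<in> parcs (ofg m n) \<Longrightarrow> (Y, X) \<in> parcs (ofg m n)"
    using arcs_symmetric by simp
qed

text \<open>The colour change at the one differing cell is lifted to an integer \<open>e\<close>.
  The lifted function then agrees modulo 3, up to rotation, with a height function of
  \<open>Y\<close>, and this forces it to be a height function itself.\<close>

lemma arc_imp_flip:
  assumes mn: "1 \<le> m" "1 \<le> n" and h: "h \<in> heights m n"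
    and arc: "(ofg_vertex m n h, Y) \<in> parcs (ofg m n)"
  obtains v e where "v \<in> pverts (grid m n)" "\<bar>e\<bar> = 2" "h(v := h v + e) \<in> heights m n"
    "Y = ofg_vertex m n (h(v := h v + e))"
proof -
  from arc obtain c d where Y: "Y \<in> pverts (ofg m n)"
    and c: "c \<in> ofg_vertex m n h" and d: "d \<in> Y"
    and ex1: "\<exists>!v. v \<in> pverts (grid m n) \<and> c v \<noteq> d v"
    unfolding ofg_arc_iff by blast
  from Y bij_betw_ofg_vertex[OF mn] obtain h' where "h' \<in> normalised_heights m n"
    and Yh': "Y = ofg_vertex m n h'"
    unfolding bij_betw_def by blast
  then have h': "h' \<in> heights m n" "Y = ofg_vertex m n h'"
    by (simp_all only: normalised_heights_iff)
  from c obtain k where "c = (\<lambda>v \<in> pverts (grid m n). of_int (h v) + k)"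
    by (auto simp only: mem_ofg_vertex)
  then have ck: "c v = of_int (h v) + k" if "v \<in> pverts (grid m n)" for v
    using that by (simp del: grid_pverts)
  from d obtain l where "d = (\<lambda>v \<in> pverts (grid m n). of_int (h' v) + l)"
    unfolding h'(2) by (auto simp only: mem_ofg_vertex)
  then have dl: "d v = of_int (h' v) + l" if "v \<in> pverts (grid m n)" for v
    using that by (simp del: grid_pverts)
  from ex1 obtain v where v: "v \<in> pverts (grid m n)" "c v \<noteq> d v"
    and same: "\<And>u. u \<in> pverts (grid m n) \<Longrightarrow> u \<noteq> v \<Longrightarrow> c u = d u"
    by blast
  \<comment> \<open>The nonzero residues 1 and 2 are lifted to -2 and 2. An odd lift such as 1 would
    spoil the parity of the differences to the neighbours.\<close>
  have "\<exists>e. \<bar>e\<bar> = 2 \<and> (of_int e :: 3) = d v - c v"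
  proof -
    have "d v - c v \<noteq> 0" using v(2) by simp
    then have "d v - c v = of_int (-2) \<or> d v - c v = of_int 2"
      by (cases "d v - c v" rule: Z3_cases) auto
    then show ?thesis by (metis abs_minus_cancel abs_numeral)
  qed
  then obtain e where e: "\<bar>e\<bar> = 2" "(of_int e :: 3) = d v - c v" by blast
  define g where "g = h(v := h v + e)"
  \<comment> \<open>Off \<open>v\<close> the colours \<open>c\<close> and \<open>d\<close> agree,
    and at \<open>v\<close> the choice of \<open>e\<close> compensates their difference; the common
    rotation is \<open>l - k\<close>.\<close>
  have g_eq: "(of_int (g u) :: 3) = of_int (h' u) + (l - k)" if u: "u \<in> pverts (grid m n)" for u
  proof (cases "u = v")
    case True
    then show ?thesis using ck[OF u] dl[OF u] e(2) by (simp add: g_def)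
  next
    case False
    then show ?thesis using ck[OF u] dl[OF u] same[OF u] by (simp add: g_def algebra_simps)
  qed
  have "g \<in> heights m n"
    unfolding g_def
  proof (rule flip_heights[OF h v(1)])
    fix w assume vw: "(v, w) \<in> parcs (grid m n)"
    have "w \<noteq> v" using vw by (cases w) (auto simp: parcs_grid_iff)
    then have gw: "g w = h w" by (simp add: g_def)
    \<comment> \<open>The new difference is odd and at most 3 in absolute value; being congruent to
      1 or -1 modulo 3, it cannot be 3 or -3.\<close>
    have "(of_int (g v) :: 3) - of_int (g w) = of_int (h' v) - of_int (h' w)"
      using g_eq[OF v(1)] g_eq[OF grid_arc_in_verts(2)[OF vw]] by simp
    then have "(of_int (g v - g w) :: 3) = of_int (h' v - h' w)" by simp
    then have "3 dvd (g v - g w - (h' v - h' w))" by (simp only: of_int_3_eq_iff)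
    moreover have "\<bar>h' v - h' w\<bar> = 1" "\<bar>h v - h w\<bar> = 1"
      using heights_arc[OF h'(1) vw] heights_arc[OF h vw] .
    moreover have "g v - g w = h v + e - h w" using gw by (simp add: g_def)
    ultimately show "\<bar>h v + e - h w\<bar> = 1" using e(1) by presburger
  qed
  moreover have "Y = ofg_vertex m n g"
    unfolding h'(2) by (rule sym, rule ofg_vertex_eqI, rule g_eq)
  ultimately show thesis using that v(1) e(1) unfolding g_def by blast
qed

section \<open>Flip walks and the l1 distance between height functions\<close>

text \<open>By \<open>arc_imp_flip\<close> each arc adds at most 2 to the sum. The parity at
  \<open>(1, 1)\<close> is carried along so that the final renormalisation is a shift by twice an
  integer, as \<open>disp\<close> of the halved difference requires.\<close>

lemma walk_moves_heights:
  assumes mn: "1 \<le> m" "1 \<le> n" and h: "h \<in> heights m n"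
    and "(ofg_vertex m n h, Y) \<in> parcs (ofg m n) ^^ k"
  shows "\<exists>g \<in> heights m n. Y = ofg_vertex m n g \<and>
    (\<Sum>v \<in> pverts (grid m n). \<bar>g v - h v\<bar>) \<le> 2 * int k \<and> even (g (1, 1) - h (1, 1))"
  using assms(4)
proof (induction k arbitrary: Y)
  case 0
  then show ?case using h by (intro bexI[of _ h]) auto
next
  case (Suc k)
  from Suc.prems obtain X where X: "(ofg_vertex m n h, X) \<in> parcs (ofg m n) ^^ k"
    "(X, Y) \<in> parcs (ofg m n)"
    by (rule relpow_Suc_E)
  from Suc.IH[OF X(1)] obtain g where g: "g \<in> heights m n" "X = ofg_vertex m n g"
    "(\<Sum>v \<in> pverts (grid m n). \<bar>g v - h v\<bar>) \<le> 2 * int k" "even (g (1, 1) - h (1, 1))"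
    by blast
  from arc_imp_flip[OF mn g(1)] X(2) g(2) obtain v e where v: "v \<in> pverts (grid m n)"
    and e: "\<bar>e\<bar> = 2" and g': "g(v := g v + e) \<in> heights m n"
    "Y = ofg_vertex m n (g(v := g v + e))"
    by metis
  have "(\<Sum>u \<in> pverts (grid m n). \<bar>(g(v := g v + e)) u - h u\<bar>) \<le>
      (\<Sum>u \<in> pverts (grid m n). \<bar>g u - h u\<bar> + (if u = v then 2 else 0))"
    using e by (intro sum_mono) auto
  also have "\<dots> = (\<Sum>u \<in> pverts (grid m n). \<bar>g u - h u\<bar>) + 2"
    using v by (simp add: sum.distrib)
  also have "\<dots> \<le> 2 * int (Suc k)" using g(3) by simp
  finally have "(\<Sum>u \<in> pverts (grid m n). \<bar>(g(v := g v + e)) u - h u\<bar>) \<le> 2 * int (Suc k)" .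
  moreover have "even e" using e by presburger
  then have "even ((g(v := g v + e)) (1, 1) - h (1, 1))"
    using g(4) by (cases "v = (1, 1)") simp_all
  ultimately show ?case using g' by (intro bexI[of _ "g(v := g v + e)"] conjI)
qed

lemma flip_towards:
  assumes g: "g \<in> heights m n" and g': "g' \<in> heights m n"
    and even: "\<And>v. v \<in> pverts (grid m n) \<Longrightarrow> even (g' v - g v)"
    and v0: "v0 \<in> pverts (grid m n)" "g v0 < g' v0"
  obtains v where "v \<in> pverts (grid m n)" "g v + 2 \<le> g' v" "g(v := g v + 2) \<in> heights m n"
proof -
  define A where "A = {v \<in> pverts (grid m n). g v < g' v}"
  have "finite A" by (simp add: A_def)
  moreover have "A \<noteq> {}" using v0 unfolding A_def by blast
  ultimately obtain v where v: "v \<in> A" and min: "\<And>w. w \<in> A \<Longrightarrow> g v \<le> g w"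
    by (metis arg_min_if_finite(1) arg_min_least)
  have vV: "v \<in> pverts (grid m n)" and lt: "g v < g' v"
    using v by (simp_all add: A_def del: grid_pverts)
  \<comment> \<open>Parity widens the gap from 1 to 2, so the raised value does not overshoot
    \<open>g'\<close>.\<close>
  from even[OF vV] lt have le: "g v + 2 \<le> g' v" by presburger
  have "g(v := g v + 2) \<in> heights m n"
  proof (rule flip_heights[OF g vV])
    fix w assume vw: "(v, w) \<in> parcs (grid m n)"
    \<comment> \<open>Such a neighbour satisfies
      \<open>g' w \<ge> g' v - 1 \<ge> g v + 1 > g w\<close>, so it would lie in \<open>A\<close>
      below the minimum \<open>g v\<close>.\<close>
    have "w \<in> A" if "g w = g v - 1"
      using that le heights_arc[OF g' vw] grid_arc_in_verts(2)[OF vw] by (auto simp: A_def simp del: grid_pverts)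
    with min[of w] have "g w \<noteq> g v - 1" by auto
    with heights_arc[OF g vw] show "\<bar>g v + 2 - g w\<bar> = 1" by linarith
  qed
  with vV le that show thesis by blast
qed

lemma flip_decreases_sum:
  fixes g g' :: "'a \<Rightarrow> int"
  assumes "finite V" "v \<in> V" "g v + 2 \<le> g' v"
  shows "(\<Sum>u \<in> V. \<bar>g' u - (g(v := g v + 2)) u\<bar>) = (\<Sum>u \<in> V. \<bar>g' u - g u\<bar>) - 2"
  using assms by (simp add: sum.remove[of V v])

text \<open>Induction on half the l1 distance. Only raising flips are used: where \<open>g\<close>
  exceeds \<open>g'\<close>, the target \<open>g'\<close> is raised instead. The length is only
  bounded by \<open>k\<close>, since the sum may be smaller and a flip may fail to be an
  arc.\<close>

lemma flips_connect_heights: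
  assumes mn: "1 \<le> m" "1 \<le> n"
  shows "g \<in> heights m n \<Longrightarrow> g' \<in> heights m n \<Longrightarrow>
    (\<And>v. v \<in> pverts (grid m n) \<Longrightarrow> even (g' v - g v)) \<Longrightarrow>
    (\<Sum>v \<in> pverts (grid m n). \<bar>g' v - g v\<bar>) \<le> 2 * int k \<Longrightarrow>
    \<exists>j \<le> k. (ofg_vertex m n g, ofg_vertex m n g') \<in> parcs (ofg m n) ^^ j"
proof (induction k arbitrary: g g')
  case 0
  then have "(\<Sum>v \<in> pverts (grid m n). \<bar>g' v - g v\<bar>) = 0"
    by (intro antisym sum_nonneg) auto
  then have "\<forall>v \<in> pverts (grid m n). \<bar>g' v - g v\<bar> = 0"
    by (subst (asm) sum_nonneg_eq_0_iff) auto
  then have "g = g'" using 0 by (intro heights_ext[of g m n g']) (auto simp del: grid_pverts)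
  then show ?case by auto
next
  case (Suc k)
  let ?V = "pverts (grid m n)"
  consider (up) v where "v \<in> ?V" "g v < g' v" | (down) v where "v \<in> ?V" "g' v < g v"
    | (eq) "\<And>v. v \<in> ?V \<Longrightarrow> g v = g' v"
    by (meson linorder_neqE)
  then show ?case
  proof cases
    case up
    from flip_towards[OF Suc.prems(1-3) up] obtain v where v: "v \<in> ?V" "g v + 2 \<le> g' v"
      and f: "g(v := g v + 2) \<in> heights m n"
      by metis
    let ?f = "g(v := g v + 2)"
    have "even (g' u - ?f u)" if "u \<in> ?V" for u
      using Suc.prems(3)[OF that] by auto
    moreover have "(\<Sum>u \<in> ?V. \<bar>g' u - ?f u\<bar>) \<le> 2 * int k"
      using flip_decreases_sum[of ?V v g g'] v Suc.prems(4) by simp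
    ultimately obtain j where j: "j \<le> k" "(ofg_vertex m n ?f, ofg_vertex m n g') \<in> parcs (ofg m n) ^^ j"
      using Suc.IH[OF f Suc.prems(2)] by blast
    show ?thesis
    \<comment> \<open>If the flip leaves the orbit unchanged, the walk from \<open>?f\<close>
      already starts at the right vertex and no arc is added.\<close>
    proof (cases "ofg_vertex m n g = ofg_vertex m n ?f")
      case True
      then show ?thesis using j by (auto intro: le_SucI)
    next
      case False
      from relpow_Suc_I2[OF flip_imp_arc[OF mn Suc.prems(1) v(1) f False] j(2)] j(1)
      show ?thesis by (meson Suc_le_mono)
    qed
  next
    case down
    have ev: "even (g u - g' u)" if "u \<in> ?V" for u
      using Suc.prems(3)[OF that] by presburger
    \<comment> \<open>The roles are exchanged: \<open>g'\<close> is raised towards \<open>g\<close>,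
      and the arc so obtained is reversed to become the last step of the walk.\<close>
    from flip_towards[OF Suc.prems(2,1) ev down] obtain v where v: "v \<in> ?V" "g' v + 2 \<le> g v"
      and f: "g'(v := g' v + 2) \<in> heights m n"
      by metis
    let ?f = "g'(v := g' v + 2)"
    have "even (?f u - g u)" if "u \<in> ?V" for u
      using Suc.prems(3)[OF that] by auto
    moreover have "(\<Sum>u \<in> ?V. \<bar>?f u - g u\<bar>) \<le> 2 * int k"
      using flip_decreases_sum[of ?V v g' g] v Suc.prems(4) by (simp add: abs_minus_commute)
    ultimately obtain j where j: "j \<le> k" "(ofg_vertex m n g, ofg_vertex m n ?f) \<in> parcs (ofg m n) ^^ j"
      using Suc.IH[OF Suc.prems(1) f] by blast
    show ?thesis
    proof (cases "ofg_vertex m n g' = ofg_vertex m n ?f")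
      case True
      then show ?thesis using j by (auto intro: le_SucI)
    next
      case False
      from relpow_Suc_I[OF j(2) ofg_arc_sym[OF flip_imp_arc[OF mn Suc.prems(2) v(1) f False]]] j(1)
      show ?thesis by (meson Suc_le_mono)
    qed
  next
    case eq
    then have "g = g'" using Suc.prems by (intro heights_ext[of g m n g']) auto
    then show ?thesis by (intro exI[of _ 0]) auto
  qed
qed

section \<open>Displacement\<close>

lemma disp_le: "disp m n \<phi> \<le> (\<Sum>v \<in> pverts (grid m n). nat \<bar>\<phi> v - K\<bar>)"
  unfolding disp_def by (rule Least_le) blast

lemma disp_attained: obtains K where "disp m n \<phi> = (\<Sum>v \<in> pverts (grid m n). nat \<bar>\<phi> v - K\<bar>)"
  using LeastI_ex[of "\<lambda>s. \<exists>K :: int. s = (\<Sum>v \<in> pverts (grid m n). nat \<bar>\<phi> v - K\<bar>)"]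
  unfolding disp_def by blast

lemma halved_difference_iff:
  "halved_difference m n h h' \<phi> \<longleftrightarrow> (\<forall>v \<in> pverts (grid m n). h' v - h v = 2 * \<phi> v)"
proof -
  have "real_of_int (\<phi> v) = (real_of_int (h' v) - real_of_int (h v)) / 2 \<longleftrightarrow>
      real_of_int (h' v - h v) = real_of_int (2 * \<phi> v)" for v
    by auto
  then have "real_of_int (\<phi> v) = (real_of_int (h' v) - real_of_int (h v)) / 2 \<longleftrightarrow>
      h' v - h v = 2 * \<phi> v" for v
    by (simp only: of_int_eq_iff)
  then show ?thesis by (simp add: halved_difference_def)
qed

lemma graph_dist_eq_disp:
  assumes mn: "1 \<le> m" "1 \<le> n"
    and h: "h \<in> normalised_heights m n" and h': "h' \<in> normalised_heights m n"
    and \<phi>: "\<And>v. v \<in> pverts (grid m n) \<Longrightarrow> h' v - h v = 2 * \<phi> v"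
  shows "graph_dist (ofg m n) (ofg_vertex m n h) (ofg_vertex m n h') = ereal (disp m n \<phi>)"
proof (rule antisym)
  let ?V = "pverts (grid m n)"
  have abs_double: "\<bar>2 * a\<bar> = 2 * int (nat \<bar>a\<bar>)" for a :: int
    by (simp add: abs_mult)
  interpret pair_graph "ofg m n" by (rule pair_graph_ofg)
  have wf: "pair_wf_digraph (ofg m n)" by (rule pair_wf_digraph)
  have hH: "h \<in> heights m n" "h' \<in> heights m n" using h h' by (auto simp: normalised_heights_iff)
  obtain K where K: "disp m n \<phi> = (\<Sum>v \<in> ?V. nat \<bar>\<phi> v - K\<bar>)" by (rule disp_attained)
  \<comment> \<open>With \<open>K\<close> a minimiser for \<open>disp\<close>, this shift of
    \<open>h'\<close> stays in the same orbit, and its l1 distance from \<open>h\<close> is exactly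
    twice the displacement.\<close>
  let ?g = "\<lambda>v \<in> ?V. h' v + - 2 * K"
  have diff: "?g v - h v = 2 * (\<phi> v - K)" if "v \<in> ?V" for v
    using \<phi>[OF that] that by (simp del: grid_pverts)
  have "(\<Sum>v \<in> ?V. \<bar>?g v - h v\<bar>) = (\<Sum>v \<in> ?V. 2 * int (nat \<bar>\<phi> v - K\<bar>))"
    by (rule sum.cong[OF refl]) (simp only: diff abs_double)
  also have "\<dots> = 2 * int (disp m n \<phi>)"
    unfolding K of_nat_sum sum_distrib_left ..
  finally have "(\<Sum>v \<in> ?V. \<bar>?g v - h v\<bar>) \<le> 2 * int (disp m n \<phi>)" by simp
  moreover have "even (?g v - h v)" if "v \<in> ?V" for v
    using diff[OF that] by (simp del: grid_pverts)
  moreover have "?g \<in> heights m n" by (rule heights_shift[OF hH(2)])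
  ultimately obtain j where j: "j \<le> disp m n \<phi>"
    "(ofg_vertex m n h, ofg_vertex m n ?g) \<in> parcs (ofg m n) ^^ j"
    using flips_connect_heights[OF mn hH(1)] by blast
  have "graph_dist (ofg m n) (ofg_vertex m n h) (ofg_vertex m n h') \<le> ereal j"
    by (rule graph_dist_le[OF wf ofg_vertex_in[OF h]]) (use j(2) in \<open>simp only: ofg_vertex_shift\<close>)
  also have "\<dots> \<le> ereal (disp m n \<phi>)" using j(1) by simp
  finally show "graph_dist (ofg m n) (ofg_vertex m n h) (ofg_vertex m n h') \<le> ereal (disp m n \<phi>)" .
  show "ereal (disp m n \<phi>) \<le> graph_dist (ofg m n) (ofg_vertex m n h) (ofg_vertex m n h')"
  proof (rule graph_dist_ge[OF wf])
    fix k assume "(ofg_vertex m n h, ofg_vertex m n h') \<in> parcs (ofg m n) ^^ k"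
    from walk_moves_heights[OF mn hH(1) this] obtain g where g: "g \<in> heights m n"
      "ofg_vertex m n g = ofg_vertex m n h'" "(\<Sum>v \<in> ?V. \<bar>g v - h v\<bar>) \<le> 2 * int k"
      "even (g (1, 1) - h (1, 1))"
      by metis
    from g(4) h have "even (g (1, 1))" by (simp add: normalised_heights_iff)
    then obtain L where L: "g (1, 1) = 2 * L" by blast
    \<comment> \<open>The endpoint \<open>g\<close> is \<open>h'\<close> shifted by
      \<open>2 * L\<close>, so \<open>- L\<close> is an admissible constant in
      \<open>disp\<close>.\<close>
    have "g v - h v = 2 * (\<phi> v - (- L))" if "v \<in> ?V" for v
      using ofg_vertex_eqD[OF mn g(1) h' g(2) that] \<phi>[OF that] L by simp
    then have "(\<Sum>v \<in> ?V. \<bar>g v - h v\<bar>) = (\<Sum>v \<in> ?V. 2 * int (nat \<bar>\<phi> v - (- L)\<bar>))"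
      by (intro sum.cong[OF refl]) (simp only: abs_double)
    also have "\<dots> = 2 * int (\<Sum>v \<in> ?V. nat \<bar>\<phi> v - (- L)\<bar>)"
      unfolding of_nat_sum sum_distrib_left ..
    finally have "(\<Sum>v \<in> ?V. nat \<bar>\<phi> v - (- L)\<bar>) \<le> k" using g(3) by linarith
    then show "disp m n \<phi> \<le> k" using disp_le[of m n \<phi> "- L"] by linarith
  qed
qed

section \<open>Halved differences and finiteness of the displacement values\<close>

text \<open>Both heights vanish at \<open>(1, 1)\<close>, so their difference is even everywhere and
  \<open>div\<close> is exact. Along an edge the difference changes by -2, 0 or 2, hence its half by
  at most 1.\<close>

lemma exists_halved_difference:
  assumes h: "h \<in> normalised_heights m n" and h': "h' \<in> normalised_heights m n"
  obtains \<phi> where "\<phi> \<in> lipschitz_functions m n" "halved_difference m n h h' \<phi>"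
proof -
  define \<phi> where "\<phi> = (\<lambda>v \<in> pverts (grid m n). (h' v - h v) div 2)"
  have hH: "h \<in> heights m n" "h' \<in> heights m n" "h (1, 1) = 0" "h' (1, 1) = 0"
    using h h' by (auto simp: normalised_heights_iff)
  have \<phi>: "h' v - h v = 2 * \<phi> v" if "v \<in> pverts (grid m n)" for v
    using even_height_diff[OF hH(2,1) _ that] that hH by (simp add: \<phi>_def del: grid_pverts)
  have "\<bar>\<phi> u - \<phi> v\<bar> \<le> 1" if uv: "(u, v) \<in> parcs (grid m n)" for u v
    using heights_arc[OF hH(1) uv] heights_arc[OF hH(2) uv]
      \<phi>[OF grid_arc_in_verts(1)[OF uv]] \<phi>[OF grid_arc_in_verts(2)[OF uv]]
    by linarith
  moreover have "\<phi> \<in> pverts (grid m n) \<rightarrow>\<^sub>E UNIV"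
    unfolding \<phi>_def by simp
  ultimately have "\<phi> \<in> lipschitz_functions m n"
    unfolding lipschitz_functions_def by blast
  with \<phi> show thesis by (intro that) (auto simp only: halved_difference_iff)
qed

text \<open>The path through \<open>(i, 1)\<close> to \<open>(i, j)\<close> has
  \<open>i + j - 2\<close> steps; this cruder bound suffices for finiteness.\<close>

lemma lipschitz_bound:
  assumes \<phi>: "\<phi> \<in> lipschitz_functions m n" and v: "v \<in> pverts (grid m n)"
  shows "\<bar>\<phi> v - \<phi> (1, 1)\<bar> \<le> int (m + n)"
proof -
  have lip: "\<bar>\<phi> u - \<phi> w\<bar> \<le> 1" if "(u, w) \<in> parcs (grid m n)" for u w
    using \<phi> that by (auto simp: lipschitz_functions_def)
  have col: "1 \<le> i \<Longrightarrow> i \<le> m \<Longrightarrow> 1 \<le> n \<Longrightarrow> \<bar>\<phi> (i, 1) - \<phi> (1, 1)\<bar> \<le> int i" for i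
  proof (induction i rule: nat_induct_at_least)
    case (Suc i)
    then show ?case using lip[of "(i, 1)" "(Suc i, 1)"] by (auto simp: parcs_grid_iff)
  qed simp
  have "1 \<le> j \<Longrightarrow> j \<le> n \<Longrightarrow> 1 \<le> i \<Longrightarrow> i \<le> m \<Longrightarrow> \<bar>\<phi> (i, j) - \<phi> (1, 1)\<bar> \<le> int (i + j)" for i j
  proof (induction j rule: nat_induct_at_least)
    case base
    then show ?case using col[of i] by auto
  next
    case (Suc j)
    then show ?case using lip[of "(i, j)" "(i, Suc j)"] by (auto simp: parcs_grid_iff)
  qed
  with v show ?thesis by (cases v) force
qed

text \<open>On a nonempty grid, adding constants gives infinitely many Lipschitz functions, so
  finiteness is a matter of the values of \<open>disp\<close>. The choice
  \<open>K = \<phi> (1, 1)\<close> bounds them uniformly.\<close>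

lemma finite_disp_lipschitz: "finite (disp m n ` lipschitz_functions m n)"
proof (rule finite_subset)
  show "disp m n ` lipschitz_functions m n \<subseteq> {..card (pverts (grid m n)) * (m + n)}"
  proof (rule image_subsetI)
    fix \<phi> assume "\<phi> \<in> lipschitz_functions m n"
    then have "nat \<bar>\<phi> v - \<phi> (1, 1)\<bar> \<le> m + n" if "v \<in> pverts (grid m n)" for v
      using lipschitz_bound[OF _ that, of \<phi>] by linarith
    then have "(\<Sum>v \<in> pverts (grid m n). nat \<bar>\<phi> v - \<phi> (1, 1)\<bar>) \<le>
        of_nat (card (pverts (grid m n))) * (m + n)"
      by (rule sum_bounded_above)
    with disp_le[of m n \<phi> "\<phi> (1, 1)"] show "disp m n \<phi> \<in> {..card (pverts (grid m n)) * (m + n)}"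
      by (simp del: grid_pverts)
  qed
qed simp

text \<open>Nonemptiness and finiteness belong to the claim because they give the occurrences of
  \<open>Max\<close> their meaning.\<close>

theorem proposition4p2:
  fixes m n :: nat
  assumes "1 \<le> m" and "1 \<le> n"
  shows "(\<forall>h \<in> normalised_heights m n. \<forall>h' \<in> normalised_heights m n.
            \<exists>\<phi> \<in> lipschitz_functions m n.
              halved_difference m n h h' \<phi> \<and>
              graph_dist (ofg m n) (ofg_vertex m n h) (ofg_vertex m n h') = ereal (disp m n \<phi>)) \<and>
         realisable_functions m n \<noteq> {} \<and> finite (disp m n ` lipschitz_functions m n) \<and>
         graph_diam (ofg m n) = ereal (Max (disp m n ` realisable_functions m n)) \<and>
         Max (disp m n ` realisable_functions m n) \<le> Max (disp m n ` lipschitz_functions m n)"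
proof -
  let ?H = "normalised_heights m n" and ?R = "realisable_functions m n"
  have dist: "graph_dist (ofg m n) (ofg_vertex m n h) (ofg_vertex m n h') = ereal (disp m n \<phi>)"
    if "h \<in> ?H" "h' \<in> ?H" "halved_difference m n h h' \<phi>" for h h' \<phi>
    using that by (intro graph_dist_eq_disp[OF assms]) (auto simp only: halved_difference_iff)
  have first: "\<exists>\<phi> \<in> lipschitz_functions m n. halved_difference m n h h' \<phi> \<and>
      graph_dist (ofg m n) (ofg_vertex m n h) (ofg_vertex m n h') = ereal (disp m n \<phi>)"
    if "h \<in> ?H" "h' \<in> ?H" for h h'
    using exists_halved_difference[OF that] dist[OF that] by metis
  have verts: "pverts (ofg m n) = ofg_vertex m n ` ?H"
    using bij_betw_ofg_vertex[OF assms] by (simp add: bij_betw_def)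
  \<comment> \<open>A sample height function, increasing by 1 in both directions; it shows that
    there are pairs of heights and hence realisable functions.\<close>
  have "(\<lambda>(i, j) \<in> pverts (grid m n). int (i + j) - 2) \<in> ?H"
    unfolding normalised_heights_iff
    using assms by (intro conjI heightsI) (auto simp: parcs_grid_iff)
  then have nonempty: "?R \<noteq> {}"
    using first by (fastforce simp: realisable_functions_def)
  have sub: "disp m n ` ?R \<subseteq> disp m n ` lipschitz_functions m n"
    by (auto simp: realisable_functions_def)
  have fin: "finite (disp m n ` ?R)"
    by (rule finite_subset[OF sub finite_disp_lipschitz])
  have dists: "{graph_dist (ofg m n) u v | u v. u \<in> pverts (ofg m n) \<and> v \<in> pverts (ofg m n)} =
      (\<lambda>d. ereal (real d)) ` disp m n ` ?R"
  proof (intro set_eqI iffI)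
    fix x assume "x \<in> {graph_dist (ofg m n) u v | u v. u \<in> pverts (ofg m n) \<and> v \<in> pverts (ofg m n)}"
    then obtain h h' where hh: "h \<in> ?H" "h' \<in> ?H"
      "x = graph_dist (ofg m n) (ofg_vertex m n h) (ofg_vertex m n h')"
      unfolding verts by blast
    from first[OF hh(1,2)] hh show "x \<in> (\<lambda>d. ereal (real d)) ` disp m n ` ?R"
      by (force simp: realisable_functions_def)
  next
    fix x assume "x \<in> (\<lambda>d. ereal (real d)) ` disp m n ` ?R"
    then obtain \<phi> h h' where "x = ereal (disp m n \<phi>)" and hh: "h \<in> ?H" "h' \<in> ?H"
      "halved_difference m n h h' \<phi>"
      by (auto simp: realisable_functions_def)
    with dist[OF hh] have "x = graph_dist (ofg m n) (ofg_vertex m n h) (ofg_vertex m n h')"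
      by simp
    with hh show "x \<in> {graph_dist (ofg m n) u v | u v. u \<in> pverts (ofg m n) \<and> v \<in> pverts (ofg m n)}"
      unfolding verts by blast
  qed
  \<comment> \<open>A monotone embedding commutes with \<open>Max\<close> on finite nonempty sets,
    which moves the maximum from extended reals to naturals.\<close>
  have "mono (\<lambda>d :: nat. ereal (real d))" by (rule monoI) simp
  from mono_Max_commute[OF this fin] nonempty
  have "graph_diam (ofg m n) = ereal (Max (disp m n ` ?R))"
    unfolding graph_diam_def dists by simp
  moreover have "Max (disp m n ` ?R) \<le> Max (disp m n ` lipschitz_functions m n)"
    using nonempty by (intro Max_mono[OF sub] finite_disp_lipschitz) simp
  ultimately show ?thesis using first nonempty finite_disp_lipschitz by blast
qed

end
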